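(* Let $\mathcal{L}$ be a $\lambda$-graph bisystem satisfying FPCC. The configuration space $\mathcal{X}_{\mathcal{L}}$ (with the metric $d$) is a compact totally disconnected metric space.
   Context: **$\lambda$-graph bisystem.** Let $\Sigma$ be a finite set. A $\lambda$-graph bisystem $\mathcal{L}=(\mathcal{L}^-,\mathcal{L}^+)$ over $\Sigma$ consists of two labeled Bratteli diagrams $\mathcal{L}^{-}=(V,E^{-},\lambda^{-})$, $\mathcal{L}^{+}=(V,E^{+},\lambda^{+})$ with common vertex set $V=\bigcup_{l\ge 0}V_l$ and edge sets $E^-=\bigcup_{l\ge0}E^-_{l+1,l}$, $E^+=\bigcup_{l\ge0}E^+_{l,l+1}$ (all $V_l$, $E^-_{l+1,l}$, $E^+_{l,l+1}$ are finite, nonempty and pairwise disjoint, and $V_0$ is a singleton). An edge $e^-\in E^-_{l+1,l}$ has source $s(e^-)\in V_{l+1}$ and terminal $t(e^-)\in V_l$; an edge $e^+\in E^+_{l,l+1}$ has source $s(e^+)\in V_l$ and terminal $t(e^+)\in V_{l+1}$; labels are given by $\lambda^\pm:E^\pm\to\Sigma$. Required: (1) $\mathcal{L}^-$ is right-resolving: distinct $e^-,f^-\in E^-_{l+1,l}$ with $s(e^-)=s(f^-)$ have $\lambda^-(e^-)\neq\lambda^-(f^-)$; (2) $\mathcal{L}^+$ is left-resolving: distinct $e^+,f^+\in E^+_{l,l+1}$ with $t(e^+)=t(f^+)$ have $\lambda^+(e^+)\ne\lambda^+(f^+)$; (3) local property: for all $u\in V_l$, $v\in V_{l+2}$ there is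 a bijection $\phi$ from $\{(f^+,f^-)\in E^+_{l,l+1}\times E^-_{l+2,l+1}: s(f^+)=u,\ t(f^+)=t(f^-),\ s(f^-)=v\}$ onto $\{(e^-,e^+)\in E^-_{l+1,l}\times E^+_{l+1,l+2}: t(e^-)=u,\ s(e^-)=s(e^+),\ t(e^+)=v\}$ such that $\phi(f^+,f^-)=(e^-,e^+)$ implies $\lambda^+(f^+)=\lambda^+(e^+)$ and $\lambda^-(f^-)=\lambda^-(e^-)$. For $v\in V_l$, let $F(v)\subset\Sigma^l$ be the set of words $(\lambda^-(e^-_l),\dots,\lambda^-(e^-_1))$ with $e^-_n\in E^-_{n,n-1}$, $s(e^-_l)=v$, $t(e_n^-)=s(e_{n-1}^-)$, and let $P(v)\subset\Sigma^l$ be the set of words $(\lambda^+(e^+_1),\dots,\lambda^+(e^+_l))$ with $e^+_n\in E^+_{n-1,n}$, $t(e^+_l)=v$, $s(e^+_n)=t(e^+_{n-1})$. FPCC means $F(v)=P(v)$ for all $v\in V$. **Configuration space.** Let $\mathbb{Z}^2[<]=\{(k,l)\in\mathbb{Z}^2: k<l\}$, $n(k,l)=l-k-1$, $V_{(k,l)}=V_{n(k,l)}$, $E^-_{(k-1,k),l}=E^-_{n(k-1,l),n(k,l)}$, $E^+_{k,(l,l+1)}=E^+_{n(k,l),n(k,l+1)}$. $\mathcal{X}_{\mathcal{L}}$ is the set of configurations $x=\{(v_{(k,l)},e^-_{(k-1,k),l},e^+_{k,(l,l+1)})\}_{(k,l)\in\mathbb{Z}^2[<]}$ with $v_{(k,l)}\in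 V_{(k,l)}$, $e^-_{(k-1,k),l}\in E^-_{(k-1,k),l}$, $e^+_{k,(l,l+1)}\in E^+_{k,(l,l+1)}$, such that $s(e^-_{(k-1,k),l})=v_{(k-1,l)}$, $t(e^-_{(k-1,k),l})=v_{(k,l)}$, $s(e^+_{k,(l,l+1)})=v_{(k,l)}$, $t(e^+_{k,(l,l+1)})=v_{(k,l+1)}$, and such that there is $(x_n)_{n\in\mathbb{Z}}\in\Sigma^{\mathbb{Z}}$ with $\lambda^-(e^-_{(k-1,k),l})=x_k$ and $\lambda^+(e^+_{k,(l,l+1)})=x_l$ for all $(k,l)\in\mathbb{Z}^2[<]$. **Metric.** For $(p,q)\in\mathbb{Z}^2[<]$ the $(p,q)$-triangle $\triangle_{(p,q)}(x)$ is the restriction of $x$ to the vertices $v_{(k,l)}$ with $p\le k<l\le q$ and all edges of $x$ joining such vertices. For $x,z\in\mathcal{X}_{\mathcal{L}}$: $d(x,x)=0$; $d(x,z)=1$ if $\triangle_{(-1,1)}(x)\neq\triangle_{(-1,1)}(z)$; and $d(x,z)=2^{-p}$ if $p\ge1$, $\triangle_{(-p,p)}(x)=\triangle_{(-p,p)}(z)$ and $\triangle_{(-p-1,p+1)}(x)\neq\triangle_{(-p-1,p+1)}(z)$. The topology induced by $d$ has as an open base the sets $U_{(\mu;v)}$ ($v\in V_{(p,q)}$, $\mu\in P(v)$, $(p,q)\in\mathbb{Z}^2[<]$), where $U_{(\mu;v)}$ is the set of $x\in\mathcal{X}_{\mathcal{L}}$ whose vertex at $(p,q)$ is $v$ and whose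 labels satisfy $(x_{p+1},\dots,x_{q-1})=\mu$. *)

theory Defs
  imports "HOL-Analysis.Analysis"
begin

section \<open>Lambda-graph bisystems\<close>

text \<open>
  Vertices, edges of \<open>L\<^sup>-\<close> and edges of \<open>L\<^sup>+\<close> have separate types, so these three kinds of
  objects are automatically disjoint from each other.  Edge sets are indexed by the smaller of
  the two levels they join: \<open>medges L l\<close> is \<open>E\<^sup>-\<close> at \<open>(l+1, l)\<close>, and \<open>pedges L l\<close> is \<open>E\<^sup>+\<close> at
  \<open>(l, l+1)\<close>.
\<close>

record ('v, 'm, 'p, 'a) bisystem =
  verts :: "nat \<Rightarrow> 'v set"
  medges :: "nat \<Rightarrow> 'm set"
  msrc :: "'m \<Rightarrow> 'v"
  mtgt :: "'m \<Rightarrow> 'v"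
  mlab :: "'m \<Rightarrow> 'a"
  pedges :: "nat \<Rightarrow> 'p set"
  psrc :: "'p \<Rightarrow> 'v"
  ptgt :: "'p \<Rightarrow> 'v"
  plab :: "'p \<Rightarrow> 'a"

definition right_resolving :: "('v, 'm, 'p, 'a) bisystem \<Rightarrow> bool" where
  "right_resolving L \<longleftrightarrow>
     (\<forall>l. \<forall>e\<in>medges L l. \<forall>f\<in>medges L l.
        e \<noteq> f \<and> msrc L e = msrc L f \<longrightarrow> mlab L e \<noteq> mlab L f)"

definition left_resolving :: "('v, 'm, 'p, 'a) bisystem \<Rightarrow> bool" where
  "left_resolving L \<longleftrightarrow>
     (\<forall>l. \<forall>e\<in>pedges L l. \<forall>f\<in>pedges L l.
        e \<noteq> f \<and> ptgt L e = ptgt L f \<longrightarrow> plab L e \<noteq> plab L f)"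

definition pm_paths :: "('v, 'm, 'p, 'a) bisystem \<Rightarrow> nat \<Rightarrow> 'v \<Rightarrow> 'v \<Rightarrow> ('p \<times> 'm) set" where
  "pm_paths L l u v =
     {(f, g). f \<in> pedges L l \<and> g \<in> medges L (l + 1) \<and>
              psrc L f = u \<and> ptgt L f = mtgt L g \<and> msrc L g = v}"

definition mp_paths :: "('v, 'm, 'p, 'a) bisystem \<Rightarrow> nat \<Rightarrow> 'v \<Rightarrow> 'v \<Rightarrow> ('m \<times> 'p) set" where
  "mp_paths L l u v =
     {(g, f). g \<in> medges L l \<and> f \<in> pedges L (l + 1) \<and>
              mtgt L g = u \<and> msrc L g = psrc L f \<and> ptgt L f = v}"

definition local_property :: "('v, 'm, 'p, 'a) bisystem \<Rightarrow> bool" where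
  "local_property L \<longleftrightarrow>
     (\<forall>l. \<forall>u\<in>verts L l. \<forall>v\<in>verts L (l + 2).
        \<exists>\<phi>. bij_betw \<phi> (pm_paths L l u v) (mp_paths L l u v) \<and>
            (\<forall>f g g' f'. (f, g) \<in> pm_paths L l u v \<and> \<phi> (f, g) = (g', f') \<longrightarrow>
               plab L f = plab L f' \<and> mlab L g = mlab L g'))"

locale lambda_graph_bisystem =
  fixes \<Sigma> :: "'a set" and L :: "('v, 'm, 'p, 'a) bisystem"
  assumes finite_alphabet: "finite \<Sigma>"
    and finite_verts: "finite (verts L l)"
    and finite_medges: "finite (medges L l)"
    and finite_pedges: "finite (pedges L l)"
    and verts_nonempty: "verts L l \<noteq> {}"
    and medges_nonempty: "medges L l \<noteq> {}"
    and pedges_nonempty: "pedges L l \<noteq> {}"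
    and disjoint_verts: "disjoint_family (verts L)"
    and disjoint_medges: "disjoint_family (medges L)"
    and disjoint_pedges: "disjoint_family (pedges L)"
    and root: "is_singleton (verts L 0)"
    and msrc_in: "e \<in> medges L l \<Longrightarrow> msrc L e \<in> verts L (l + 1)"
    and mtgt_in: "e \<in> medges L l \<Longrightarrow> mtgt L e \<in> verts L l"
    and mlab_in: "e \<in> medges L l \<Longrightarrow> mlab L e \<in> \<Sigma>"
    and psrc_in: "f \<in> pedges L l \<Longrightarrow> psrc L f \<in> verts L l"
    and ptgt_in: "f \<in> pedges L l \<Longrightarrow> ptgt L f \<in> verts L (l + 1)"
    and plab_in: "f \<in> pedges L l \<Longrightarrow> plab L f \<in> \<Sigma>"
    and right_resolving: "right_resolving L"
    and left_resolving: "left_resolving L"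
    and local_property: "local_property L"

text \<open>
  The word sets \<open>F(v)\<close> and \<open>P(v)\<close> for a vertex \<open>v\<close> of level \<open>l\<close>.  Only the values
  \<open>e 1, \<dots>, e l\<close> matter, and for \<open>l = 0\<close> both sets consist of the empty word alone.
\<close>

definition follower_words :: "('v, 'm, 'p, 'a) bisystem \<Rightarrow> nat \<Rightarrow> 'v \<Rightarrow> 'a list set" where
  "follower_words L l v =
     {map (\<lambda>n. mlab L (e n)) (rev [1..<l + 1]) | e.
        (\<forall>n\<in>{1..l}. e n \<in> medges L (n - 1)) \<and>
        (l \<ge> 1 \<longrightarrow> msrc L (e l) = v) \<and>
        (\<forall>n\<in>{2..l}. mtgt L (e n) = msrc L (e (n - 1)))}"

definition predecessor_words :: "('v, 'm, 'p, 'a) bisystem \<Rightarrow> nat \<Rightarrow> 'v \<Rightarrow> 'a list set" where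
  "predecessor_words L l v =
     {map (\<lambda>n. plab L (e n)) [1..<l + 1] | e.
        (\<forall>n\<in>{1..l}. e n \<in> pedges L (n - 1)) \<and>
        (l \<ge> 1 \<longrightarrow> ptgt L (e l) = v) \<and>
        (\<forall>n\<in>{2..l}. psrc L (e n) = ptgt L (e (n - 1)))}"

definition FPCC :: "('v, 'm, 'p, 'a) bisystem \<Rightarrow> bool" where
  "FPCC L \<longleftrightarrow> (\<forall>l. \<forall>v\<in>verts L l. follower_words L l v = predecessor_words L l v)"


section \<open>The configuration space\<close>

definition Z2_less :: "(int \<times> int) set" where
  "Z2_less = {(k, l). k < l}"

definition lev :: "int \<Rightarrow> int \<Rightarrow> nat" where
  "lev k l = nat (l - k - 1)"

text \<open>
  A configuration assigns to each \<open>(k, l)\<close> with \<open>k < l\<close> the triple consisting of the vertex at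
  \<open>(k, l)\<close>, the \<open>L\<^sup>-\<close> edge from \<open>(k-1, l)\<close> to \<open>(k, l)\<close> and the \<open>L\<^sup>+\<close> edge from \<open>(k, l)\<close> to
  \<open>(k, l+1)\<close>; outside \<open>Z2_less\<close> it is \<open>undefined\<close>, so equality of configurations is equality
  of families indexed by \<open>Z2_less\<close>.
\<close>

type_synonym ('v, 'm, 'p) config = "int \<times> int \<Rightarrow> 'v \<times> 'm \<times> 'p"

definition cvert :: "('v, 'm, 'p) config \<Rightarrow> int \<times> int \<Rightarrow> 'v" where
  "cvert x i = fst (x i)"

definition cmedge :: "('v, 'm, 'p) config \<Rightarrow> int \<times> int \<Rightarrow> 'm" where
  "cmedge x i = fst (snd (x i))"

definition cpedge :: "('v, 'm, 'p) config \<Rightarrow> int \<times> int \<Rightarrow> 'p" where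
  "cpedge x i = snd (snd (x i))"

definition config_space ::
    "'a set \<Rightarrow> ('v, 'm, 'p, 'a) bisystem \<Rightarrow> ('v, 'm, 'p) config set" where
  "config_space \<Sigma> L =
     {x \<in> extensional Z2_less.
        (\<forall>(k, l)\<in>Z2_less.
           cvert x (k, l) \<in> verts L (lev k l) \<and>
           cmedge x (k, l) \<in> medges L (lev k l) \<and>
           cpedge x (k, l) \<in> pedges L (lev k l) \<and>
           msrc L (cmedge x (k, l)) = cvert x (k - 1, l) \<and>
           mtgt L (cmedge x (k, l)) = cvert x (k, l) \<and>
           psrc L (cpedge x (k, l)) = cvert x (k, l) \<and>
           ptgt L (cpedge x (k, l)) = cvert x (k, l + 1)) \<and>
        (\<exists>\<xi> :: int \<Rightarrow> 'a. (\<forall>n. \<xi> n \<in> \<Sigma>) \<and>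
           (\<forall>(k, l)\<in>Z2_less. mlab L (cmedge x (k, l)) = \<xi> k \<and> plab L (cpedge x (k, l)) = \<xi> l))}"


section \<open>The metric\<close>

text \<open>
  An edge belongs to the \<open>(p, q)\<close>-triangle iff both of its end vertices do; this is why the two
  edge families are restricted to smaller index sets than the vertices.
\<close>

definition triangle :: "int \<Rightarrow> int \<Rightarrow> ('v, 'm, 'p) config \<Rightarrow>
    (int \<times> int \<Rightarrow> 'v) \<times> (int \<times> int \<Rightarrow> 'm) \<times> (int \<times> int \<Rightarrow> 'p)" where
  "triangle p q x =
     (restrict (cvert x) {(k, l). p \<le> k \<and> k < l \<and> l \<le> q},
      restrict (cmedge x) {(k, l). p \<le> k - 1 \<and> k < l \<and> l \<le> q},
      restrict (cpedge x) {(k, l). p \<le> k \<and> k < l \<and> l + 1 \<le> q})"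

definition config_dist :: "('v, 'm, 'p) config \<Rightarrow> ('v, 'm, 'p) config \<Rightarrow> real" where
  "config_dist x z =
     (if x = z then 0
      else if triangle (- 1) 1 x \<noteq> triangle (- 1) 1 z then 1
      else 1 / 2 ^ (THE p::nat. p \<ge> 1 \<and>
             triangle (- int p) (int p) x = triangle (- int p) (int p) z \<and>
             triangle (- int p - 1) (int p + 1) x \<noteq> triangle (- int p - 1) (int p + 1) z))"

definition totally_disconnected_space :: "'b topology \<Rightarrow> bool" where
  "totally_disconnected_space T \<longleftrightarrow> (\<forall>S. connectedin T S \<longrightarrow> (\<exists>a. S \<subseteq> {a}))"

end

theory Submission
  imports Defs
begin

text \<open>
  The theorem holds because the distance is that of a tree of approximations.  The triangles
  \<open>triangle (-n) n\<close> increase with \<open>n\<close> and exhaust the index set, and the distance of distinct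
  configurations is \<open>1 / 2 ^ n\<close> for the last \<open>n\<close> at which their triangles agree.  Hence a closed
  ball of radius \<open>1 / 2 ^ n\<close> consists of the configurations that share one triangle of size \<open>n\<close>
  (\<open>config_dist_le_iff\<close>).  All three claims follow from this description.

  Agreement on a triangle is an equivalence relation, so the distance is an ultrametric
  (\<open>config_dist_ultrametric\<close>), and in an ultrametric space balls are open and closed and
  separate points (\<open>ultrametric_totally_disconnected\<close>).

  For compactness, total boundedness and completeness are shown.  Only finitely many triangles of
  a given size exist, because all levels of the bisystem are finite; this is total boundedness.
  Completeness rests on \<open>config_space\<close> being cut out by conditions that each involve
  finitely many coordinates.  The existence of the label sequence is not of this form as it stands,
  but the sequence can be read off from the \<open>L\<^sup>-\<close> edges at \<open>(k, k+1)\<close>, and then it is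
  (\<open>config_space_iff_local\<close>).  Each coordinate of a Cauchy sequence is eventually constant, and
  the configuration of the eventual values satisfies every such condition, since some member of
  the sequence agrees with it on all the coordinates that the condition mentions.
\<close>

lemma ultrametric_totally_disconnected:
  assumes "Metric_space M d"
    and ultra: "\<And>x y z. x \<in> M \<Longrightarrow> y \<in> M \<Longrightarrow> z \<in> M \<Longrightarrow> d x z \<le> max (d x y) (d y z)"
  shows "totally_disconnected_space (Metric_space.mtopology M d)"
proof -
  interpret Metric_space M d by fact
  have False if S: "connectedin mtopology S" and ab: "a \<in> S" "b \<in> S" "a \<noteq> b" for S a b
  proof -
    have SM: "S \<subseteq> M" using connectedin_subset_topspace[OF S] by simp
    define r where "r = d a b"
    have aM: "a \<in> M" and bM: "b \<in> M" using SM ab by auto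
    have r: "r > 0" using ab aM bM by (simp add: r_def)
    \<comment> \<open>The ball of radius \<open>r\<close> about \<open>a\<close> misses \<open>b\<close>, and two points at distance less than \<open>r\<close> lie
        on the same side of it, which makes its complement open.\<close>
    have "mball x r \<subseteq> M - mball a r" if x: "x \<in> M - mball a r" for x
    proof
      fix y assume y: "y \<in> mball x r"
      have "y \<notin> mball a r"
        using ultra[of a y x] x y aM commute[of x y] by auto
      then show "y \<in> M - mball a r" using y by auto
    qed
    then have "openin mtopology (M - mball a r)"
      unfolding openin_mtopology using r by blast
    moreover have "openin mtopology (mball a r)" by simp
    moreover have "a \<in> mball a r \<inter> S" "b \<in> (M - mball a r) \<inter> S"
      using aM bM ab r by (auto simp: r_def)
    moreover have "S \<subseteq> mball a r \<union> (M - mball a r)" using SM by blast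
    ultimately show False using S unfolding connectedin by blast
  qed
  then show ?thesis unfolding totally_disconnected_space_def by blast
qed

section \<open>Nested triangles\<close>

abbreviation central_triangle where
  "central_triangle n \<equiv> triangle (- int n) (int n)"

lemma restrict_eq_iff: "restrict f A = restrict g A \<longleftrightarrow> (\<forall>i\<in>A. f i = g i)"
  by (metis restrict_apply' restrict_ext)

lemma triangle_eq_iff:
  "triangle p q x = triangle p q z \<longleftrightarrow>
     (\<forall>k l. k < l \<longrightarrow>
        (p \<le> k \<and> l \<le> q \<longrightarrow> cvert x (k, l) = cvert z (k, l)) \<and>
        (p \<le> k - 1 \<and> l \<le> q \<longrightarrow> cmedge x (k, l) = cmedge z (k, l)) \<and>
        (p \<le> k \<and> l + 1 \<le> q \<longrightarrow> cpedge x (k, l) = cpedge z (k, l)))"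
  unfolding triangle_def prod.inject restrict_eq_iff by auto

lemma triangle_eq_mono:
  assumes "triangle p q x = triangle p q z" "p \<le> p'" "q' \<le> q"
  shows "triangle p' q' x = triangle p' q' z"
  using assms unfolding triangle_eq_iff by force

lemma central_triangle_eq_mono:
  assumes "central_triangle n x = central_triangle n z" "m \<le> n"
  shows "central_triangle m x = central_triangle m z"
  using triangle_eq_mono[OF assms(1)] assms(2) by simp

text \<open>
  The strict bounds are due to the edges stored at \<open>(k, l)\<close>: they reach \<open>(k-1, l)\<close> and
  \<open>(k, l+1)\<close>, which have to lie in the triangle too.
\<close>
lemma triangle_eq_imp_coordinate_eq:
  assumes "triangle p q x = triangle p q z" "p < k" "k < l" "l < q"
  shows "x (k, l) = z (k, l)"
  using assms unfolding triangle_eq_iff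
  by (auto simp: prod_eq_iff cvert_def cmedge_def cpedge_def)

lemma ex_central_triangle_neq:
  assumes "x \<in> extensional Z2_less" "z \<in> extensional Z2_less" "x \<noteq> z"
  shows "\<exists>n. central_triangle n x \<noteq> central_triangle n z"
proof -
  obtain k l where kl: "k < l" "x (k, l) \<noteq> z (k, l)"
    using assms extensionalityI[of x Z2_less z] by (auto simp: Z2_less_def)
  define n where "n = nat (max \<bar>k\<bar> \<bar>l\<bar> + 1)"
  have "- int n < k" "l < int n" by (auto simp: n_def)
  then show ?thesis using triangle_eq_imp_coordinate_eq[of _ _ x z k l] kl by blast
qed

section \<open>The distance as an ultrametric\<close>

text \<open>
  The triangle of size \<open>0\<close> is empty, so every two configurations agree on it, and the clause of
  the definition giving distance \<open>1\<close> becomes the case \<open>n = 0\<close> of the general clause.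
\<close>
lemma config_dist_eq_last_agreement:
  assumes "x \<in> extensional Z2_less" "z \<in> extensional Z2_less" "x \<noteq> z"
  obtains n where "config_dist x z = 1 / 2 ^ n"
    "central_triangle n x = central_triangle n z"
    "central_triangle (Suc n) x \<noteq> central_triangle (Suc n) z"
proof -
  define m where "m = (LEAST n. central_triangle n x \<noteq> central_triangle n z)"
  have m: "central_triangle m x \<noteq> central_triangle m z"
    unfolding m_def using ex_central_triangle_neq[OF assms] by (rule LeastI_ex)
  have less: "central_triangle n x = central_triangle n z" if "n < m" for n
    using not_less_Least[of n] that unfolding m_def by blast
  have "central_triangle 0 x = central_triangle 0 z" by (auto simp: triangle_eq_iff)
  then obtain n where n: "m = Suc n" using m by (cases m) auto
  have Suc_eq: "central_triangle (Suc p) y = triangle (- int p - 1) (int p + 1) y" for p y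
    by (rule arg_cong2[where f = "\<lambda>a b. triangle a b y"]) auto
  have neq: "triangle (- int n - 1) (int n + 1) x \<noteq> triangle (- int n - 1) (int n + 1) z"
    using m unfolding n Suc_eq .
  have "config_dist x z = 1 / 2 ^ n"
  proof (cases "n = 0")
    case True
    then show ?thesis using neq assms(3) by (simp add: config_dist_def)
  next
    case False
    have "triangle (- 1) 1 x = triangle (- 1) 1 z" using less[of 1] False n by simp
    moreover have "(THE p. p \<ge> 1 \<and> central_triangle p x = central_triangle p z \<and>
        triangle (- int p - 1) (int p + 1) x \<noteq> triangle (- int p - 1) (int p + 1) z) = n"
    proof (rule the_equality)
      fix p :: nat
      assume p: "p \<ge> 1 \<and> central_triangle p x = central_triangle p z \<and>
        triangle (- int p - 1) (int p + 1) x \<noteq> triangle (- int p - 1) (int p + 1) z"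
      then have "central_triangle (Suc p) x \<noteq> central_triangle (Suc p) z"
        unfolding Suc_eq by blast
      then have "m \<le> Suc p" using less[of "Suc p"] by force
      moreover have "p < m" using p m central_triangle_eq_mono[of p x z m] by (meson not_less)
      ultimately show "p = n" by (simp add: n)
    qed (use False less[of n] n neq in auto)
    ultimately show ?thesis using assms(3) by (simp add: config_dist_def)
  qed
  then show ?thesis using that[of n] m less[of n] n by auto
qed

lemma config_dist_le_iff:
  assumes "x \<in> extensional Z2_less" "z \<in> extensional Z2_less"
  shows "config_dist x z \<le> 1 / 2 ^ n \<longleftrightarrow> central_triangle n x = central_triangle n z"
proof (cases "x = z")
  case True
  then show ?thesis by (simp add: config_dist_def)
next
  case False
  obtain p where p: "config_dist x z = 1 / 2 ^ p"
    "central_triangle p x = central_triangle p z"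
    "central_triangle (Suc p) x \<noteq> central_triangle (Suc p) z"
    using config_dist_eq_last_agreement[OF assms False] .
  have "config_dist x z \<le> 1 / 2 ^ n \<longleftrightarrow> n \<le> p"
    by (simp add: p(1) field_simps)
  also have "\<dots> \<longleftrightarrow> central_triangle n x = central_triangle n z"
    using central_triangle_eq_mono[OF p(2), of n] central_triangle_eq_mono[of n x z "Suc p"] p(3)
    by (auto simp: not_le Suc_le_eq[symmetric] intro: leI)
  finally show ?thesis .
qed

lemma config_dist_commute: "config_dist x z = config_dist z x"
  by (simp add: config_dist_def eq_commute)

lemma config_dist_nonneg: "0 \<le> config_dist x z"
  by (simp add: config_dist_def)

lemma config_dist_eq_0_iff: "config_dist x z = 0 \<longleftrightarrow> x = z"
  by (simp add: config_dist_def)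

lemma config_dist_ultrametric:
  assumes "x \<in> extensional Z2_less" "y \<in> extensional Z2_less" "z \<in> extensional Z2_less"
  shows "config_dist x z \<le> max (config_dist x y) (config_dist y z)"
proof (cases "x = y \<or> y = z")
  case True
  then show ?thesis by auto
next
  case False
  obtain a where a: "config_dist x y = 1 / 2 ^ a"
    using config_dist_eq_last_agreement[of x y] assms False by blast
  obtain b where b: "config_dist y z = 1 / 2 ^ b"
    using config_dist_eq_last_agreement[of y z] assms False by blast
  have max: "max (config_dist x y) (config_dist y z) = 1 / 2 ^ min a b"
    by (cases a b rule: le_cases) (auto simp: a b max_def min_def field_simps)
  then have "config_dist x y \<le> 1 / 2 ^ min a b" "config_dist y z \<le> 1 / 2 ^ min a b"
    by linarith+
  then have "central_triangle (min a b) x = central_triangle (min a b) z"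
    using assms by (simp add: config_dist_le_iff)
  then show ?thesis using assms by (simp add: max config_dist_le_iff)
qed

lemma config_space_extensional: "x \<in> config_space \<Sigma> L \<Longrightarrow> x \<in> extensional Z2_less"
  by (simp add: config_space_def)

lemma config_dist_Metric_space: "Metric_space (config_space \<Sigma> L) config_dist"
proof
  fix x y z
  assume "x \<in> config_space \<Sigma> L" "y \<in> config_space \<Sigma> L" "z \<in> config_space \<Sigma> L"
  then have "config_dist x z \<le> max (config_dist x y) (config_dist y z)"
    by (intro config_dist_ultrametric config_space_extensional)
  then show "config_dist x z \<le> config_dist x y + config_dist y z"
    using config_dist_nonneg[of x y] config_dist_nonneg[of y z] by linarith
qed (auto simp: config_dist_nonneg config_dist_eq_0_iff config_dist_commute)

section \<open>Total boundedness\<close>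

lemma finite_central_triangles:
  assumes "lambda_graph_bisystem \<Sigma> L"
  shows "finite (central_triangle n ` config_space \<Sigma> L)"
proof -
  interpret lambda_graph_bisystem \<Sigma> L by fact
  define A where "A = {(k, l). - int n \<le> k \<and> k < l \<and> l \<le> int n}"
  define B where "B = {(k, l). - int n \<le> k - 1 \<and> k < l \<and> l \<le> int n}"
  define C where "C = {(k, l). - int n \<le> k \<and> k < l \<and> l + 1 \<le> int n}"
  have "finite ({- int n..int n} \<times> {- int n..int n})" by simp
  moreover have "A \<subseteq> {- int n..int n} \<times> {- int n..int n}"
    "B \<subseteq> {- int n..int n} \<times> {- int n..int n}" "C \<subseteq> {- int n..int n} \<times> {- int n..int n}"
    by (auto simp: A_def B_def C_def)
  ultimately have fin: "finite A" "finite B" "finite C"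
    by (blast intro: finite_subset)+
  have "triangle (- int n) (int n) x \<in>
      (\<Pi>\<^sub>E (k, l)\<in>A. verts L (lev k l)) \<times>
      (\<Pi>\<^sub>E (k, l)\<in>B. medges L (lev k l)) \<times>
      (\<Pi>\<^sub>E (k, l)\<in>C. pedges L (lev k l))" if x: "x \<in> config_space \<Sigma> L" for x
  proof -
    have coord: "cvert x (k, l) \<in> verts L (lev k l)" "cmedge x (k, l) \<in> medges L (lev k l)"
      "cpedge x (k, l) \<in> pedges L (lev k l)" if "k < l" for k l
      using x that unfolding config_space_def Z2_less_def by blast+
    show ?thesis
      unfolding triangle_def A_def[symmetric] B_def[symmetric] C_def[symmetric]
        mem_Times_iff fst_conv snd_conv restrict_PiE_iff
      using coord by (simp add: A_def B_def C_def split_beta)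
  qed
  then have "central_triangle n ` config_space \<Sigma> L \<subseteq>
      (\<Pi>\<^sub>E (k, l)\<in>A. verts L (lev k l)) \<times>
      (\<Pi>\<^sub>E (k, l)\<in>B. medges L (lev k l)) \<times>
      (\<Pi>\<^sub>E (k, l)\<in>C. pedges L (lev k l))"
    by (rule image_subsetI)
  moreover have "finite \<dots>"
    using fin finite_verts finite_medges finite_pedges
    by (intro finite_cartesian_product finite_PiE) (simp_all add: split_beta)
  ultimately show ?thesis by (rule finite_subset)
qed

lemma config_space_mtotally_bounded:
  assumes "lambda_graph_bisystem \<Sigma> L"
  shows "Metric_space.mtotally_bounded (config_space \<Sigma> L) config_dist (config_space \<Sigma> L)"
proof -
  interpret Metric_space "config_space \<Sigma> L" config_dist by (rule config_dist_Metric_space)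
  show ?thesis unfolding mtotally_bounded_def
  proof (intro allI impI)
    fix \<epsilon> :: real assume "\<epsilon> > 0"
    then obtain n where n: "1 / 2 ^ n < \<epsilon>"
      using real_arch_pow_inv[of \<epsilon> "1 / 2"] by (auto simp: power_divide)
    \<comment> \<open>One representative of each triangle of size \<open>n\<close> is an \<open>\<epsilon>\<close>-net.\<close>
    obtain K where K: "K \<subseteq> config_space \<Sigma> L" "finite K"
      "central_triangle n ` config_space \<Sigma> L = central_triangle n ` K"
      using finite_subset_image[OF finite_central_triangles[OF assms, of n] order_refl] by blast
    have "x \<in> (\<Union>y\<in>K. mball y \<epsilon>)" if x: "x \<in> config_space \<Sigma> L" for x
    proof -
      obtain y where y: "y \<in> K" "central_triangle n y = central_triangle n x"
        using K(3) x by (metis (no_types, lifting) imageE imageI)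
      then have "config_dist y x \<le> 1 / 2 ^ n"
        using K(1) x by (subst config_dist_le_iff) (auto intro: config_space_extensional)
      then show ?thesis using y K(1) x n by auto
    qed
    then show "\<exists>K. finite K \<and> K \<subseteq> config_space \<Sigma> L \<and> config_space \<Sigma> L \<subseteq> (\<Union>x\<in>K. mball x \<epsilon>)"
      using K by blast
  qed
qed

section \<open>Completeness\<close>

text \<open>
  The last two clauses express that labels depend on \<open>k\<close> or \<open>l\<close> alone by comparing them with the
  \<open>L\<^sup>-\<close> edges at \<open>(k, k+1)\<close> and \<open>(l, l+1)\<close>, without reference to a label sequence.
\<close>
definition local_config_condition ::
    "('v, 'm, 'p, 'a) bisystem \<Rightarrow> ('v, 'm, 'p) config \<Rightarrow> int \<Rightarrow> int \<Rightarrow> bool" where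
  "local_config_condition L x k l \<longleftrightarrow>
     cvert x (k, l) \<in> verts L (lev k l) \<and>
     cmedge x (k, l) \<in> medges L (lev k l) \<and>
     cpedge x (k, l) \<in> pedges L (lev k l) \<and>
     msrc L (cmedge x (k, l)) = cvert x (k - 1, l) \<and>
     mtgt L (cmedge x (k, l)) = cvert x (k, l) \<and>
     psrc L (cpedge x (k, l)) = cvert x (k, l) \<and>
     ptgt L (cpedge x (k, l)) = cvert x (k, l + 1) \<and>
     mlab L (cmedge x (k, l)) = mlab L (cmedge x (k, k + 1)) \<and>
     plab L (cpedge x (k, l)) = mlab L (cmedge x (l, l + 1))"

lemma local_config_condition_cong:
  assumes "k < l" "\<And>i j. k - 1 \<le> i \<Longrightarrow> i < j \<Longrightarrow> j \<le> l + 1 \<Longrightarrow> x (i, j) = z (i, j)"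
  shows "local_config_condition L x k l \<longleftrightarrow> local_config_condition L z k l"
proof -
  have "x (k, l) = z (k, l)" "x (k - 1, l) = z (k - 1, l)" "x (k, l + 1) = z (k, l + 1)"
    "x (k, k + 1) = z (k, k + 1)" "x (l, l + 1) = z (l, l + 1)"
    using assms(1) by (auto intro!: assms(2))
  then show ?thesis by (simp add: local_config_condition_def cvert_def cmedge_def cpedge_def)
qed

text \<open>
  The only candidate for the label at \<open>n\<close> is the label of the \<open>L\<^sup>-\<close> edge at \<open>(n, n+1)\<close>, so the
  quantifier over label sequences can be eliminated.
\<close>
lemma config_space_iff_local:
  assumes "lambda_graph_bisystem \<Sigma> L"
  shows "x \<in> config_space \<Sigma> L \<longleftrightarrow>
    x \<in> extensional Z2_less \<and> (\<forall>k l. k < l \<longrightarrow> local_config_condition L x k l)"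
    (is "_ \<longleftrightarrow> ?local")
proof
  assume "x \<in> config_space \<Sigma> L"
  then show ?local
    unfolding config_space_def local_config_condition_def Z2_less_def by auto
next
  assume x: ?local
  interpret lambda_graph_bisystem \<Sigma> L by fact
  define \<xi> where "\<xi> n = mlab L (cmedge x (n, n + 1))" for n
  have loc: "local_config_condition L x k l" if "k < l" for k l
    using x that by blast
  have "\<xi> n \<in> \<Sigma>" for n
  proof -
    have "cmedge x (n, n + 1) \<in> medges L (lev n (n + 1))"
      using loc[of n "n + 1"] unfolding local_config_condition_def by simp
    then show ?thesis unfolding \<xi>_def by (rule mlab_in)
  qed
  moreover have "mlab L (cmedge x (k, l)) = \<xi> k" "plab L (cpedge x (k, l)) = \<xi> l"
    if "k < l" for k l
    using loc[OF that] unfolding local_config_condition_def \<xi>_def by blast+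
  ultimately have "\<exists>\<xi>. (\<forall>n. \<xi> n \<in> \<Sigma>) \<and>
      (\<forall>(k, l)\<in>Z2_less. mlab L (cmedge x (k, l)) = \<xi> k \<and> plab L (cpedge x (k, l)) = \<xi> l)"
    unfolding Z2_less_def by blast
  moreover have "\<forall>(k, l)\<in>Z2_less.
      cvert x (k, l) \<in> verts L (lev k l) \<and>
      cmedge x (k, l) \<in> medges L (lev k l) \<and>
      cpedge x (k, l) \<in> pedges L (lev k l) \<and>
      msrc L (cmedge x (k, l)) = cvert x (k - 1, l) \<and>
      mtgt L (cmedge x (k, l)) = cvert x (k, l) \<and>
      psrc L (cpedge x (k, l)) = cvert x (k, l) \<and>
      ptgt L (cpedge x (k, l)) = cvert x (k, l + 1)"
    using loc unfolding local_config_condition_def Z2_less_def by blast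
  ultimately show "x \<in> config_space \<Sigma> L"
    using x unfolding config_space_def by blast
qed

lemma config_space_mcomplete:
  assumes "lambda_graph_bisystem \<Sigma> L"
  shows "Metric_space.mcomplete (config_space \<Sigma> L) config_dist"
proof -
  interpret Metric_space "config_space \<Sigma> L" config_dist by (rule config_dist_Metric_space)
  show ?thesis unfolding mcomplete_def
  proof (intro allI impI)
    fix \<sigma> assume "MCauchy \<sigma>"
    then have \<sigma>: "\<And>i. \<sigma> i \<in> config_space \<Sigma> L"
      and cauchy: "\<And>\<epsilon>. \<epsilon> > 0 \<Longrightarrow> \<exists>N. \<forall>i j. N \<le> i \<longrightarrow> N \<le> j \<longrightarrow> config_dist (\<sigma> i) (\<sigma> j) < \<epsilon>"
      unfolding MCauchy_def by blast+
    have "\<exists>N. \<forall>i\<ge>N. \<forall>j\<ge>N. central_triangle n (\<sigma> i) = central_triangle n (\<sigma> j)" for n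
    proof -
      obtain N where N: "\<forall>i j. N \<le> i \<longrightarrow> N \<le> j \<longrightarrow> config_dist (\<sigma> i) (\<sigma> j) < 1 / 2 ^ n"
        using cauchy[of "1 / 2 ^ n"] by auto
      have "central_triangle n (\<sigma> i) = central_triangle n (\<sigma> j)" if "N \<le> i" "N \<le> j" for i j
      proof -
        have "config_dist (\<sigma> i) (\<sigma> j) \<le> 1 / 2 ^ n"
          using N that by (simp add: less_imp_le)
        then show ?thesis
          using config_dist_le_iff[OF config_space_extensional[OF \<sigma>] config_space_extensional[OF \<sigma>]]
          by blast
      qed
      then show ?thesis by blast
    qed
    then have "\<exists>N. \<forall>n. \<forall>i\<ge>N n. \<forall>j\<ge>N n. central_triangle n (\<sigma> i) = central_triangle n (\<sigma> j)"
      by (intro choice allI)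
    then obtain N where N: "\<And>n i j. N n \<le> i \<Longrightarrow> N n \<le> j \<Longrightarrow>
        central_triangle n (\<sigma> i) = central_triangle n (\<sigma> j)"
      by blast
    \<comment> \<open>The coordinate at \<open>(k, l)\<close> is constant from the index \<open>N (r k l)\<close> on.\<close>
    define r where "r k l = nat (max \<bar>k\<bar> \<bar>l\<bar> + 1)" for k l :: int
    define x where "x = restrict (\<lambda>(k, l). \<sigma> (N (r k l)) (k, l)) Z2_less"
    have x_ext: "x \<in> extensional Z2_less" by (simp add: x_def)
    have x_eq: "x (k, l) = \<sigma> i (k, l)" if kl: "k < l" and i: "N (r k l) \<le> i" for k l i
    proof -
      have "\<sigma> (N (r k l)) (k, l) = \<sigma> i (k, l)"
      proof (rule triangle_eq_imp_coordinate_eq)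
        show "central_triangle (r k l) (\<sigma> (N (r k l))) = central_triangle (r k l) (\<sigma> i)"
          using N[OF order_refl i] .
        show "- int (r k l) < k" "l < int (r k l)" by (auto simp: r_def)
      qed (rule kl)
      then show ?thesis using kl by (simp add: x_def Z2_less_def)
    qed
    have agree: "\<exists>M. \<forall>i\<ge>M. \<forall>k l. - int n \<le> k \<and> k < l \<and> l \<le> int n \<longrightarrow> x (k, l) = \<sigma> i (k, l)" for n
    proof -
      let ?I = "{- int n..int n}"
      define M where "M = Max ((\<lambda>(k, l). N (r k l)) ` (?I \<times> ?I))"
      have M: "N (r k l) \<le> M" if "k \<in> ?I" "l \<in> ?I" for k l
        unfolding M_def using that by (intro Max_ge) auto
      have "x (k, l) = \<sigma> i (k, l)"
        if "M \<le> i" "- int n \<le> k" "k < l" "l \<le> int n" for i k l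
        using M[of k l] that by (intro x_eq) auto
      then show ?thesis by blast
    qed
    have "local_config_condition L x k l" if kl: "k < l" for k l
    proof -
      define n where "n = nat (max \<bar>k\<bar> \<bar>l\<bar> + 1)"
      obtain M where M: "\<And>i j. - int n \<le> i \<Longrightarrow> i < j \<Longrightarrow> j \<le> int n \<Longrightarrow> x (i, j) = \<sigma> M (i, j)"
        using agree[of n] by blast
      have "local_config_condition L x k l \<longleftrightarrow> local_config_condition L (\<sigma> M) k l"
        using kl by (intro local_config_condition_cong M) (auto simp: n_def)
      then show ?thesis using \<sigma>[of M] kl by (simp add: config_space_iff_local[OF assms])
    qed
    then have x: "x \<in> config_space \<Sigma> L"
      using x_ext by (simp add: config_space_iff_local[OF assms])
    have "\<exists>M. \<forall>i\<ge>M. \<sigma> i \<in> config_space \<Sigma> L \<and> config_dist (\<sigma> i) x < \<epsilon>" if "\<epsilon> > 0" for \<epsilon>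
    proof -
      obtain n where n: "1 / 2 ^ n < \<epsilon>"
        using real_arch_pow_inv[of \<epsilon> "1 / 2"] \<open>\<epsilon> > 0\<close> by (auto simp: power_divide)
      obtain M where M: "\<forall>i\<ge>M. \<forall>k l. - int n \<le> k \<and> k < l \<and> l \<le> int n \<longrightarrow> x (k, l) = \<sigma> i (k, l)"
        using agree[of n] by blast
      have "config_dist (\<sigma> i) x < \<epsilon>" if "i \<ge> M" for i
      proof -
        have "central_triangle n (\<sigma> i) = central_triangle n x"
          using M that by (auto simp: triangle_eq_iff cvert_def cmedge_def cpedge_def)
        then have "config_dist (\<sigma> i) x \<le> 1 / 2 ^ n"
          using config_dist_le_iff[OF config_space_extensional[OF \<sigma>] x_ext] by blast
        then show ?thesis using n by linarith
      qed
      then show ?thesis using \<sigma> by blast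
    qed
    then have "limitin mtopology \<sigma> x sequentially"
      using x by (simp add: limit_metric_sequentially)
    then show "\<exists>x. limitin mtopology \<sigma> x sequentially" by blast
  qed
qed

section \<open>The configuration space\<close>

theorem proposition3p5:
  fixes \<Sigma> :: "'a set" and L :: "('v, 'm, 'p, 'a) bisystem"
  assumes "lambda_graph_bisystem \<Sigma> L"
    and "FPCC L"
  shows "Metric_space (config_space \<Sigma> L) config_dist \<and>
         compact_space (Metric_space.mtopology (config_space \<Sigma> L) config_dist) \<and>
         totally_disconnected_space (Metric_space.mtopology (config_space \<Sigma> L) config_dist)"
proof -
  interpret Metric_space "config_space \<Sigma> L" config_dist by (rule config_dist_Metric_space)
  have "compact_space mtopology"
    using config_space_mcomplete[OF assms(1)] config_space_mtotally_bounded[OF assms(1)]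
    by (simp add: compact_space_eq_mcomplete_mtotally_bounded)
  moreover have "totally_disconnected_space mtopology"
    by (intro ultrametric_totally_disconnected config_dist_Metric_space config_dist_ultrametric
        config_space_extensional)
  ultimately show ?thesis using config_dist_Metric_space by blast
qed

end
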